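(* Let $C=2\sqrt{\log_2(24/7)}$ (note $C<2\sqrt{2}$). Then \[r_3(N)\ge N\cdot 2^{-(C+o(1))\sqrt{\log_2 N}},\] where the $o(1)$ term tends to $0$ as $N\to\infty$.
   Context: For a positive integer $N$, $r_3(N)$ denotes the maximum possible size of a subset $A\subseteq\{1,\dots,N\}$ such that there do not exist distinct $x,y,z\in A$ with $x+z=2y$ (i.e. $A$ contains no three-term arithmetic progression). *)

theory Defs
  imports Complex_Main
begin

definition three_AP_free :: "nat set \<Rightarrow> bool" where
  "three_AP_free A \<longleftrightarrow>
     \<not> (\<exists>x\<in>A. \<exists>y\<in>A. \<exists>z\<in>A. x \<noteq> y \<and> y \<noteq> z \<and> x \<noteq> z \<and> x + z = 2 * y)"

(* The set under Max is finite and contains 0 (take A = {}), so Max is a genuine maximum. *)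
definition r3 :: "nat \<Rightarrow> nat" where
  "r3 N = Max {card A | A. A \<subseteq> {1..N} \<and> three_AP_free A}"

definition C_const :: real where
  "C_const = 2 * sqrt (log 2 (24 / 7))"

end

theory Submission
  imports Defs "HOL-Number_Theory.Cong" "HOL-Library.FuncSet"
    "HOL-Computational_Algebra.Primes" "HOL-Real_Asymp.Real_Asymp"
begin

text \<open>
  As in Behrend's construction, one looks for a set in a high-dimensional torus together with a
  function that is strictly convex along every three-term progression of the set; a thin level
  slab of that function then contains only progressions with tiny common difference. Behrend's
  box has density 1/4 for every two dimensions. The gain comes from a set of density 7/24 in the
  two-dimensional torus whose progressions may wrap around: a linear term in the first coordinate
  of the convex function absorbs the wraps in one direction, and the shape of the set excludes
  the wraps in the other direction.

  The set is transferred to the integers by n \<mapsto> \<alpha> n + \<beta> modulo a large prime P with random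
  \<alpha> and \<beta>. A progression that survives in the slab forces its common difference to be
  multiplied by \<alpha> into a tiny box, which is so rare that one point of each such pair can be
  deleted. In 2 k dimensions the density is about (7/24)^k * N^(-1/k), and k is chosen near
  sqrt (log N / log (24/7)).
\<close>

section \<open>A planar set of density 7/24\<close>

text \<open>
  The upper part consists of two copies, half a period apart in y, of the region
  3 (x - 1/2) \<le> 2 y < min (3 (x - 1/2) + 1/2) 1. Since midpoints on a torus are only determined
  up to half periods, the height has to agree on the two copies; it depends on the offset from the
  lower boundary. The gap of width \<eta> between the parts makes the quadratic term in x dominate for
  progressions that meet both parts.
\<close>

definition lower_part :: "real \<Rightarrow> (real \<times> real) set" where
  "lower_part \<eta> = {(x, y). 0 \<le> x \<and> x < 1/2 - \<eta> \<and> 0 \<le> y \<and> y < 1/2 \<and> 2 * y < 3 * x}"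

definition upper_offset :: "real \<Rightarrow> real \<Rightarrow> real" where
  "upper_offset x y = (if 2 * y < 1 then 2 * y else 2 * y - 1) - 3 * x + 3/2"

definition upper_part :: "(real \<times> real) set" where
  "upper_part = {(x, y). 1/2 \<le> x \<and> x < 5/6 \<and> 0 \<le> y \<and> y < 1 \<and>
     0 \<le> upper_offset x y \<and> upper_offset x y < 1/2}"

definition fiber_term :: "real \<Rightarrow> real \<Rightarrow> real" where
  "fiber_term x y = (if x < 1/2 then y\<^sup>2 else (upper_offset x y)\<^sup>2)"

text \<open>Put B = 2 / \<eta>^2, so that the coefficients are 2 B + 1 and B. The linear one exceeds
  2 B because a progression with a + c = 2 b + 1 may lose up to 2 B in the quadratic term. The
  quadratic one is chosen so that outer points at least \<eta> apart in x gain at least B / 2 *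
  \<eta>^2 = 1, more than the fiber term can lose.\<close>

definition height :: "real \<Rightarrow> real \<times> real \<Rightarrow> real" where
  "height \<eta> p = (4 / \<eta>\<^sup>2 + 1) * fst p + 2 / \<eta>\<^sup>2 * (fst p)\<^sup>2 + fiber_term (fst p) (snd p)"

lemma int_zero_if_small:
  assumes "t \<in> \<int>" "-1 < t" "t < (1::real)"
  shows "t = 0"
proof -
  obtain n where "t = of_int n" using assms(1) by (auto elim: Ints_cases)
  moreover have "n = 0" using assms calculation by linarith
  ultimately show ?thesis by simp
qed

text \<open>The integer s records which of the two copies holds the point. Once s is fixed the
  offset is affine in (x, y), so a progression condition turns into a statement about
  integers.\<close>

lemma upper_partE:
  assumes "(x, y) \<in> upper_part"
  obtains s where "s = 0 \<or> s = (1::real)" "upper_offset x y = 2 * y - s - 3 * x + 3/2"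
    "0 \<le> 2 * y - s" "2 * y - s < 1" "1/2 \<le> x" "x < 5/6" "0 \<le> y" "y < 1"
    "0 \<le> upper_offset x y" "upper_offset x y < 1/2"
  using assms that[of 0] that[of 1]
  by (auto simp: upper_part_def upper_offset_def split: if_splits)

text \<open>
  The boundary slope 3/2 is chosen so that a progression with a + c = 2 b - 1 has its two outer
  ordinates adding up to less than 3 (b - 1/2), which is where twice the ordinates at b start.
\<close>

lemma no_negative_wrap:
  assumes p: "(a, ya) \<in> lower_part \<eta> \<union> upper_part"
    and q: "(b, yb) \<in> lower_part \<eta> \<union> upper_part"
    and r: "(c, yc) \<in> lower_part \<eta> \<union> upper_part"
    and "\<eta> > 0" and v: "a + c - 2 * b = -1" and w: "ya + yc - 2 * yb \<in> \<int>"
  shows False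
proof -
  have pos: "0 \<le> a" "0 \<le> c"
    using p r by (auto simp: lower_part_def upper_part_def)
  have b: "1/2 \<le> b" using v pos by linarith
  then have "(b, yb) \<in> upper_part" using q \<open>\<eta> > 0\<close> by (auto simp: lower_part_def)
  then obtain sb where sb: "sb = 0 \<or> sb = (1::real)" "upper_offset b yb = 2 * yb - sb - 3 * b + 3/2"
    "2 * yb - sb < 1" "b < 5/6" "0 \<le> upper_offset b yb" "upper_offset b yb < 1/2"
    by (elim upper_partE) blast
  have sbI: "sb \<in> \<int>" using sb by auto
  have mixed: False
    if a: "(a, ya) \<in> lower_part \<eta>" and c: "(c, yc) \<in> upper_part"
      and v: "a + c - 2 * b = -1" and w: "ya + yc - 2 * yb \<in> \<int>" for a ya c yc
  proof -
    obtain s where s: "s = 0 \<or> s = (1::real)" "upper_offset c yc = 2 * yc - s - 3 * c + 3/2"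
      "2 * yc - s < 1" "1/2 \<le> c" "0 \<le> upper_offset c yc" "upper_offset c yc < 1/2"
      using c by (elim upper_partE) blast
    \<comment> \<open>Doubling the ordinates identifies the two copies: t = 2 ya + (2 yc - s) - 2 (2
      yb - sb) + 1. Inserting 2 ya < 3 a, 2 yc - s < 3 c - 1 and 2 yb - sb \<ge> 3 b - 3/2 gives t <
      3 (a + c - 2 b) + 3 = 0, while 2 yb - sb < 1 gives t > -1.\<close>
    define t where "t = 2 * (ya + yc - 2 * yb) + (2 * sb + 1 - s)"
    have "2 * (ya + yc - 2 * yb) \<in> \<int>" by (rule Ints_mult[OF Ints_numeral w])
    moreover have "2 * sb + 1 - s \<in> \<int>" using s(1) sb(1) by auto
    ultimately have "t \<in> \<int>" unfolding t_def by (rule Ints_add)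
    moreover have "-1 < t" "t < 0"
      unfolding t_def using a s sb v by (auto simp: lower_part_def)
    ultimately show False using int_zero_if_small[of t] by simp
  qed
  \<comment> \<open>Two outer points with abscissa at least 1/2 would force b \<ge> 1, beyond the
    bound 5/6.\<close>
  have "\<not> ((a, ya) \<in> upper_part \<and> (c, yc) \<in> upper_part)"
    using v sb by (auto simp: upper_part_def)
  then consider "(a, ya) \<in> lower_part \<eta>" "(c, yc) \<in> lower_part \<eta>"
    | "(a, ya) \<in> lower_part \<eta>" "(c, yc) \<in> upper_part"
    | "(c, yc) \<in> lower_part \<eta>" "(a, ya) \<in> upper_part"
    using p r by blast
  then show False
  proof cases
    case 1
    define t where "t = ya + yc - 2 * yb + sb"
    have "t \<in> \<int>" unfolding t_def using w sbI by simp
    moreover have "-1 < t" "t < 0"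
      unfolding t_def using 1 sb v by (auto simp: lower_part_def)
    ultimately show False using int_zero_if_small[of t] by simp
  next
    case 2
    then show False using mixed v w by blast
  next
    case 3
    then show False using mixed[of c yc a ya] v w by (simp add: add.commute)
  qed
qed

section \<open>Second differences of the height along progressions of the torus\<close>

lemma midpoint_square: "x\<^sup>2 + z\<^sup>2 - 2 * y\<^sup>2 = (x - z)\<^sup>2 / 2" if "x + z = 2 * (y::real)"
proof -
  have y: "y = (x + z) / 2" using that by simp
  show ?thesis unfolding y by (simp add: power2_eq_square field_simps)
qed

lemma fiber_term_bounds:
  assumes "(x, y) \<in> lower_part \<eta> \<union> upper_part" "\<eta> > 0"
  shows "0 \<le> fiber_term x y" "fiber_term x y \<le> 1/4"
proof -
  show "0 \<le> fiber_term x y" by (simp add: fiber_term_def)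
  have "z\<^sup>2 \<le> 1/4" if "0 \<le> z" "z \<le> 1/2" for z :: real
    using power_mono[of z "1/2" 2] that by (simp add: power2_eq_square)
  then show "fiber_term x y \<le> 1/4"
    using assms by (auto simp: fiber_term_def lower_part_def upper_part_def)
qed

text \<open>The wrap a + c - 2 b is -1, 0 or 1. The value -1 is excluded by the shape of the set,
  and 1 is paid for by the linear term. For 0 the height behaves as a strictly convex function: the
  quadratic term controls x, and the fiber term controls y whenever the outer points lie in the same
  part. Leaving \<open>d\<close> free covers both coordinates by one statement.\<close>

lemma height_gain:
  assumes p: "(a, ya) \<in> lower_part \<eta> \<union> upper_part"
    and q: "(b, yb) \<in> lower_part \<eta> \<union> upper_part"
    and r: "(c, yc) \<in> lower_part \<eta> \<union> upper_part"
    and \<eta>: "0 < \<eta>" "\<eta> \<le> 1/4" and v: "a + c - 2 * b \<in> \<int>" and w: "ya + yc - 2 * yb \<in> \<int>"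
    and d: "d = \<bar>a - c\<bar> \<or> d = \<bar>ya - yc\<bar>"
  shows "height \<eta> (a, ya) + height \<eta> (c, yc) - 2 * height \<eta> (b, yb) \<ge> d\<^sup>2 / 2"
proof -
  define B where "B = 2 / \<eta>\<^sup>2"
  have "16 * \<eta>\<^sup>2 \<le> 1" using power_mono[of \<eta> "1/4" 2] \<eta> by (simp add: power2_eq_square)
  then have B: "B \<ge> 32" unfolding B_def using \<eta> by (simp add: field_simps)
  have rng: "0 \<le> a" "a < 1" "0 \<le> b" "b < 1" "0 \<le> c" "c < 1"
    "0 \<le> ya" "ya < 1" "0 \<le> yb" "yb < 1" "0 \<le> yc" "yc < 1"
    using p q r \<eta> by (auto simp: lower_part_def upper_part_def)
  have d1: "d\<^sup>2 \<le> 1" using d rng by (intro power_le_one) auto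
  define \<Delta> where "\<Delta> = fiber_term a ya + fiber_term c yc - 2 * fiber_term b yb"
  have \<Delta>: "\<Delta> \<ge> - (1/2)"
    unfolding \<Delta>_def using fiber_term_bounds[OF p \<eta>(1)] fiber_term_bounds[OF q \<eta>(1)]
      fiber_term_bounds[OF r \<eta>(1)] by linarith
  have gain: "height \<eta> (a, ya) + height \<eta> (c, yc) - 2 * height \<eta> (b, yb)
    = (2 * B + 1) * (a + c - 2 * b) + B * (a\<^sup>2 + c\<^sup>2 - 2 * b\<^sup>2) + \<Delta>"
    unfolding height_def fst_conv snd_conv B_def \<Delta>_def by (simp add: algebra_simps add_divide_distrib diff_divide_distrib)
  obtain n where n: "a + c - 2 * b = of_int n" using v by (auto elim: Ints_cases)
  have "n = -1 \<or> n = 0 \<or> n = 1" using n rng by linarith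
  then consider "a + c - 2 * b = -1" | "a + c - 2 * b = 0" | "a + c - 2 * b = 1"
    using n by auto
  then show ?thesis
  proof cases
    case 1
    then show ?thesis using no_negative_wrap[OF p q r \<eta>(1) _ w] by simp
  next
    case 3
    \<comment> \<open>The gain is at least (2 B + 1) - 2 B - 1/2 = 1/2, and d \<le> 1.\<close>
    have "b\<^sup>2 \<le> 1" using rng by (intro power_le_one) auto
    then have "a\<^sup>2 + c\<^sup>2 - 2 * b\<^sup>2 \<ge> -2"
      using zero_le_power2[of a] zero_le_power2[of c] by linarith
    then have "B * (a\<^sup>2 + c\<^sup>2 - 2 * b\<^sup>2) \<ge> B * (-2)" using B by (intro mult_left_mono) auto
    then show ?thesis unfolding gain 3 using \<Delta> d1 by simp
  next
    case 2
    have ac: "a + c = 2 * b" using 2 by simp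
    have gain2: "height \<eta> (a, ya) + height \<eta> (c, yc) - 2 * height \<eta> (b, yb)
      = B / 2 * (a - c)\<^sup>2 + \<Delta>"
      unfolding gain 2 using midpoint_square[OF ac] by simp
    consider (low) "a < 1/2" "c < 1/2" | (up) "a \<ge> 1/2" "c \<ge> 1/2"
      | (mix) "a < 1/2 \<and> c \<ge> 1/2 \<or> a \<ge> 1/2 \<and> c < 1/2" by linarith
    then show ?thesis
    proof cases
      case low
      then have "b < 1/2" using ac by linarith
      then have "ya < 1/2" "yb < 1/2" "yc < 1/2"
        using low p q r by (auto simp: lower_part_def upper_part_def)
      \<comment> \<open>All ordinates of the lower part are below 1/2, so y cannot wrap
        either.\<close>
      then have "ya + yc - 2 * yb = 0" using w rng by (intro int_zero_if_small) auto
      then have "\<Delta> = (ya - yc)\<^sup>2 / 2"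
        unfolding \<Delta>_def fiber_term_def using low \<open>b < 1/2\<close> midpoint_square[of ya yc yb] by simp
      moreover have "B / 2 * (a - c)\<^sup>2 \<ge> 1 / 2 * (a - c)\<^sup>2" using B by (intro mult_right_mono) auto
      moreover have "0 \<le> (a - c)\<^sup>2" "0 \<le> (ya - yc)\<^sup>2" by auto
      moreover have "d\<^sup>2 = (a - c)\<^sup>2 \<or> d\<^sup>2 = (ya - yc)\<^sup>2" using d by auto
      ultimately show ?thesis unfolding gain2 by linarith
    next
      case up
      then have bu: "b \<ge> 1/2" using ac by linarith
      have mem: "(a, ya) \<in> upper_part" "(b, yb) \<in> upper_part" "(c, yc) \<in> upper_part"
        using up bu p q r \<eta> by (auto simp: lower_part_def)
      obtain sa where sa: "sa = 0 \<or> sa = (1::real)"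
        "upper_offset a ya = 2 * ya - sa - 3 * a + 3/2"
        "0 \<le> upper_offset a ya" "upper_offset a ya < 1/2"
        using mem(1) by (elim upper_partE) blast
      obtain sb where sb: "sb = 0 \<or> sb = (1::real)"
        "upper_offset b yb = 2 * yb - sb - 3 * b + 3/2"
        "0 \<le> upper_offset b yb" "upper_offset b yb < 1/2"
        using mem(2) by (elim upper_partE) blast
      obtain sc where sc: "sc = 0 \<or> sc = (1::real)"
        "upper_offset c yc = 2 * yc - sc - 3 * c + 3/2"
        "0 \<le> upper_offset c yc" "upper_offset c yc < 1/2"
        using mem(3) by (elim upper_partE) blast
      define u where "u = upper_offset a ya + upper_offset c yc - 2 * upper_offset b yb"
      have u: "u = 2 * (ya + yc - 2 * yb) - (sa + sc - 2 * sb)"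
        unfolding u_def sa(2) sb(2) sc(2) using ac by (simp add: algebra_simps)
      have "sa + sc - 2 * sb \<in> \<int>" using sa(1) sb(1) sc(1) by auto
      then have "u \<in> \<int>" unfolding u by (rule Ints_diff[OF Ints_mult[OF Ints_numeral w]])
      \<comment> \<open>Offsets lie in [0, 1/2), so their second difference lies strictly between -1
        and 1; this is why the strips have offset width 1/2.\<close>
      then have u0: "u = 0"
        using sa sb sc by (intro int_zero_if_small) (auto simp: u_def)
      \<comment> \<open>If the outer points lay on different copies, sa + sc - 2 sb would be odd,
        yet it equals twice the integer ya + yc - 2 yb. On a common copy the difference of the
        ordinates is determined by the offsets and abscissae.\<close>
      have "sa = sc"
      proof (rule ccontr)
        assume "sa \<noteq> sc"
        then have "sa + sc = 1" using sa sc by auto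
        then have *: "2 * (ya + yc - 2 * yb) = 1 - 2 * sb" using u u0 by simp
        obtain j where "ya + yc - 2 * yb = of_int j" using w by (auto elim: Ints_cases)
        moreover obtain l where "sb = of_int l" using sb(1) by (metis of_int_0 of_int_1)
        ultimately have "real_of_int (2 * j) = of_int (1 - 2 * l)" using * by simp
        then have "2 * j = 1 - 2 * l" by (simp only: of_int_eq_iff)
        then show False by presburger
      qed
      define e where "e = upper_offset a ya - upper_offset c yc"
      have \<Delta>e: "\<Delta> = e\<^sup>2 / 2"
        unfolding \<Delta>_def fiber_term_def e_def
        using up bu midpoint_square[of "upper_offset a ya" "upper_offset c yc" "upper_offset b yb"] u0
        by (simp add: u_def)
      have dy: "ya - yc = e / 2 + 3 / 2 * (a - c)"
        unfolding e_def using sa(2) sc(2) \<open>sa = sc\<close> by (simp add: field_simps)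
      \<comment> \<open>Parallelogram identity for e / 2 and 3 / 2 * (a - c); the square subtracted
        is dropped afterwards, and the large quadratic coefficient absorbs 9 / 2.\<close>
      have "(ya - yc)\<^sup>2 = e\<^sup>2 / 2 + 9 / 2 * (a - c)\<^sup>2 - (e / 2 - 3 / 2 * (a - c))\<^sup>2"
        unfolding dy by (simp add: power2_eq_square field_simps)
      moreover have "0 \<le> (e / 2 - 3 / 2 * (a - c))\<^sup>2" by simp
      ultimately have "(ya - yc)\<^sup>2 \<le> e\<^sup>2 / 2 + 9 / 2 * (a - c)\<^sup>2" by linarith
      moreover have "B / 2 * (a - c)\<^sup>2 \<ge> 16 * (a - c)\<^sup>2" using B by (intro mult_right_mono) auto
      moreover have "0 \<le> (a - c)\<^sup>2" "0 \<le> e\<^sup>2" by auto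
      moreover have "d\<^sup>2 = (a - c)\<^sup>2 \<or> d\<^sup>2 = (ya - yc)\<^sup>2" using d by auto
      ultimately show ?thesis unfolding gain2 \<Delta>e by linarith
    next
      case mix
      \<comment> \<open>The outer points are separated by the gap between the parts, so the
        quadratic term gains at least 1 and at least 1/2 remains after the fiber term.\<close>
      then have "\<eta> \<le> \<bar>a - c\<bar>"
        using p r by (auto simp: lower_part_def upper_part_def)
      then have "\<eta>\<^sup>2 \<le> (a - c)\<^sup>2" using \<eta> abs_le_square_iff[of \<eta> "a - c"] by simp
      then have "B / 2 * (a - c)\<^sup>2 \<ge> B / 2 * \<eta>\<^sup>2" using B by (intro mult_left_mono) auto
      moreover have "B / 2 * \<eta>\<^sup>2 = 1" unfolding B_def using \<eta> by simp
      ultimately show ?thesis unfolding gain2 using \<Delta> d1 by linarith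
    qed
  qed
qed

lemma height_bounds:
  assumes "p \<in> lower_part \<eta> \<union> upper_part" "\<eta> > 0"
  shows "0 \<le> height \<eta> p" "height \<eta> p \<le> 6 / \<eta>\<^sup>2 + 2"
proof -
  obtain x y where p: "p = (x, y)" by (cases p)
  have x: "0 \<le> x" "x \<le> 1" using assms by (auto simp: p lower_part_def upper_part_def)
  note fb = fiber_term_bounds[OF assms[unfolded p]]
  show "0 \<le> height \<eta> p" unfolding p height_def fst_conv snd_conv using x fb by simp
  define B where "B = 2 / \<eta>\<^sup>2"
  have "B \<ge> 0" by (simp add: B_def)
  then have "(2 * B + 1) * x \<le> 2 * B + 1" "B * x\<^sup>2 \<le> B"
    using x by (auto intro: mult_left_le power_le_one)
  moreover have "height \<eta> p = (2 * B + 1) * x + B * x\<^sup>2 + fiber_term x y"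
    unfolding p height_def fst_conv snd_conv B_def by simp
  moreover have "6 / \<eta>\<^sup>2 = 3 * B" by (simp add: B_def)
  ultimately show "height \<eta> p \<le> 6 / \<eta>\<^sup>2 + 2" using fb by linarith
qed

section \<open>Counting grid points\<close>

definition grid :: "real \<Rightarrow> int \<Rightarrow> (int \<times> int) set" where
  "grid \<eta> P = {(X, Y) \<in> {0..<P} \<times> {0..<P}.
     (of_int X / of_int P, of_int Y / of_int P) \<in> lower_part \<eta> \<union> upper_part}"

definition column :: "real \<Rightarrow> int \<Rightarrow> int \<Rightarrow> int set" where
  "column \<eta> P X = {Y \<in> {0..<P}. (X, Y) \<in> grid \<eta> P}"

lemma finite_column [simp]: "finite (column \<eta> P X)"
  by (rule finite_subset[of _ "{0..<P}"]) (auto simp: column_def)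

lemma card_int_interval_ge:
  fixes a b :: real
  shows "b - a - 1 \<le> real (card {Y::int. a \<le> of_int Y \<and> of_int Y < b})"
proof -
  have "{Y::int. a \<le> of_int Y \<and> of_int Y < b} = {\<lceil>a\<rceil>..<\<lceil>b\<rceil>}"
    by (auto simp: ceiling_le_iff less_ceiling_iff)
  then show ?thesis by simp linarith
qed

text \<open>Later \<open>t\<close> is \<open>P div 6\<close>, so the breakpoints 1/3, 1/2, 2/3, 5/6
  of the planar set become roughly 2 t, 3 t, 4 t, 5 t. Left of 1/3 the sloped side 2 y = 3 x is the
  binding constraint, and \<eta> \<le> 1/12 keeps the gap away.\<close>

lemma column_lower_slope:
  assumes "0 \<le> X" "X < 2 * t" "6 * t \<le> P" "0 < \<eta>" "\<eta> \<le> 1/12"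
  shows "3 / 2 * real_of_int X \<le> real (card (column \<eta> P X))"
proof -
  \<comment> \<open>The bound \<open>(3 * X + 1) div 2\<close> is 3 X / 2 rounded up, the number of
    Y \<ge> 0 with 2 Y < 3 X.\<close>
  have "{0..<(3 * X + 1) div 2} \<subseteq> column \<eta> P X"
  proof
    fix Y assume Y: "Y \<in> {0..<(3 * X + 1) div 2}"
    then have Y': "2 * Y < 3 * X" "0 \<le> Y" by auto
    then have "2 * Y < P" "3 * X < P" "0 \<le> Y" "Y < P" "X < P" using assms by linarith+
    moreover have "2 * real_of_int Y < 3 * real_of_int X" "2 * real_of_int Y < of_int P"
      "3 * real_of_int X < real_of_int P"
      using Y' calculation by linarith+
    moreover have "real_of_int X / real_of_int P < 1/2 - \<eta>"
    proof -
      have "real_of_int X / real_of_int P < 1/3"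
        using calculation assms by (simp add: divide_less_eq)
      then show ?thesis using assms by linarith
    qed
    ultimately show "Y \<in> column \<eta> P X"
      using assms by (auto simp: column_def grid_def lower_part_def field_simps)
  qed
  then have "card {0..<(3 * X + 1) div 2} \<le> card (column \<eta> P X)"
    by (intro card_mono) auto
  moreover have "3 / 2 * real_of_int X \<le> real_of_int ((3 * X + 1) div 2)" by linarith
  ultimately show ?thesis using assms by simp
qed

lemma column_lower_flat:
  assumes "2 * t \<le> X" "of_int X < 3 * real_of_int t - \<eta> * of_int P" "6 * t \<le> P" "0 < \<eta>" "0 < t"
  shows "3 * real_of_int t \<le> real (card (column \<eta> P X))"
proof -
  have "0 \<le> \<eta> * of_int P" using assms by auto
  then have X: "X < 3 * t" using assms(2) by linarith
  have "{0..<3 * t} \<subseteq> column \<eta> P X"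
  proof
    fix Y assume Y: "Y \<in> {0..<3 * t}"
    then have "2 * Y < P" "0 \<le> Y" "Y < P" "X < P" "2 * Y < 3 * X" "0 \<le> X" using assms X by auto
    moreover have "2 * real_of_int Y < 3 * real_of_int X" "2 * real_of_int Y < of_int P"
      using calculation by linarith+
    moreover have "2 * (of_int X + \<eta> * of_int P) < real_of_int P"
    proof -
      have "of_int X + \<eta> * of_int P < 3 * real_of_int t" using assms(2) by simp
      moreover have "6 * real_of_int t \<le> of_int P" using assms(3) by linarith
      ultimately show ?thesis by argo
    qed
    ultimately show "Y \<in> column \<eta> P X"
      using assms by (auto simp: column_def grid_def lower_part_def field_simps)
  qed
  then have "card {0..<3 * t} \<le> card (column \<eta> P X)"
    by (intro card_mono) auto
  then show ?thesis using assms by simp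
qed

text \<open>Each of the two copies meets the column in a half-open interval
  \<open>[a s, b s)\<close> of length min P (5 P - 6 X) / 4. Counting integers loses at most 1 per
  interval, hence the -2.\<close>

lemma column_upper:
  assumes "P \<le> 2 * X" "6 * X < 5 * P" "0 < P"
  shows "min (of_int P) (5 * of_int P - 6 * real_of_int X) / 2 - 2
    \<le> real (card (column \<eta> P X))"
proof -
  define a where "a s = (2 * s * of_int P + 6 * real_of_int X - 3 * of_int P) / 4" for s :: real
  define b where "b s = (s * of_int P + min (3 * real_of_int X - of_int P) (of_int P)) / 2" for s :: real
  define I where "I s = {Y::int. a s \<le> of_int Y \<and> of_int Y < b s}" for s
  have X: "real_of_int P \<le> 2 * of_int X" "6 * real_of_int X < 5 * of_int P"
    using assms by linarith+
  have low: "s * of_int P \<le> 2 * real_of_int Y" and up: "2 * real_of_int Y < s * of_int P + of_int P"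
    if "Y \<in> I s" for s Y
    using that X unfolding I_def a_def b_def by auto
  have sub: "I s \<subseteq> column \<eta> P X" if s: "s = 0 \<or> s = 1" for s
  proof
    fix Y assume Y: "Y \<in> I s"
    have "0 \<le> s * of_int P" "s * of_int P \<le> of_int P" using s assms by auto
    then have Yr: "0 \<le> Y" "Y < P" using low[OF Y] up[OF Y] by linarith+
    define x where "x = real_of_int X / of_int P"
    define y where "y = real_of_int Y / of_int P"
    have xy: "of_int X = x * of_int P" "of_int Y = y * of_int P" using assms by (auto simp: x_def y_def)
    have P0: "real_of_int P > 0" using assms by simp
    have Ys: "a s \<le> of_int Y" "of_int Y < b s" using Y by (simp_all add: I_def)
    have "(2 * s + 6 * x - 3) * of_int P \<le> (4 * y) * of_int P"
      using Ys(1) unfolding a_def xy by (simp add: algebra_simps)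
    then have 1: "2 * s + 6 * x - 3 \<le> 4 * y" using P0 by simp
    have "(2 * y) * of_int P < (s + 3 * x - 1) * of_int P"
      using Ys(2) unfolding b_def xy by (simp add: algebra_simps)
    then have 2: "2 * y < s + 3 * x - 1" using P0 by simp
    have "(2 * y) * of_int P < (s + 1) * of_int P"
      using up[OF Y] unfolding xy by (simp add: algebra_simps)
    then have 3: "2 * y < s + 1" using P0 by simp
    have "s * of_int P \<le> (2 * y) * of_int P"
      using low[OF Y] unfolding xy by (simp add: algebra_simps)
    then have 4: "s \<le> 2 * y" using P0 by simp
    have 5: "1/2 \<le> x" "x < 5/6" using X P0 by (auto simp: x_def field_simps)
    have "upper_offset x y = 2 * y - s - 3 * x + 3/2"
      using s 3 4 by (auto simp: upper_offset_def)
    then have "(x, y) \<in> upper_part" using 1 2 3 4 5 s by (auto simp: upper_part_def)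
    then show "Y \<in> column \<eta> P X"
      using Yr assms by (auto simp: column_def grid_def x_def y_def)
  qed
  have fin: "finite (I 0)" "finite (I 1)" by (rule finite_subset[OF sub]; simp)+
  have "I 0 \<inter> I 1 = {}" using low[of _ 1] up[of _ 0] by fastforce
  then have "card (I 0) + card (I 1) = card (I 0 \<union> I 1)" using fin by (simp add: card_Un_disjoint)
  also have "\<dots> \<le> card (column \<eta> P X)"
    by (intro card_mono) (use sub[of 0] sub[of 1] in auto)
  finally have "real (card (I 0)) + real (card (I 1)) \<le> real (card (column \<eta> P X))"
    by linarith
  moreover have "b s - a s - 1 \<le> real (card (I s))" for s
    unfolding I_def by (rule card_int_interval_ge)
  note this[of 0] this[of 1]
  moreover have "b s - a s = min (of_int P) (5 * of_int P - 6 * real_of_int X) / 4" for s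
    by (auto simp: a_def b_def min_def field_simps)
  note this[of 0] this[of 1]
  ultimately show ?thesis by linarith
qed

lemma sum_int_interval: "(\<Sum>X\<in>{a..<a + int n}. g X) = (\<Sum>j<n. g (a + int j))"
  by (rule sum.reindex_bij_witness[of _ "\<lambda>j. a + int j" "\<lambda>X. nat (X - a)"]) auto

lemma gauss_sum_lessThan: "(\<Sum>j<n. real j) = real n * (real n - 1) / 2"
  by (induction n) (auto simp: field_simps)

text \<open>The columns over four ranges of X contribute about 3, 3, 3 and 3/2 times t^2. The total
  21/2 t^2 with P about 6 t gives the density (21/2) / 36 = 7/24.\<close>

lemma card_grid_ge:
  assumes \<eta>: "0 < \<eta>" "\<eta> \<le> 1/12" and P: "12 / \<eta> \<le> of_int P"
  shows "(7/24 - \<eta>) * (of_int P)\<^sup>2 \<le> real (card (grid \<eta> P))"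
proof -
  have "144 \<le> 12 / \<eta>" using \<eta> by (simp add: field_simps)
  then have P144: "P \<ge> 144" using P by linarith
  define t where "t = nat (P div 6)"
  define e where "e = nat \<lceil>\<eta> * of_int P\<rceil>"
  have tP: "6 * int t \<le> P" "P < 6 * int t + 6" using P144 by (auto simp: t_def)
  have t24: "t \<ge> 24" using P144 by (simp add: t_def)
  have "0 \<le> \<eta> * of_int P" using \<eta> P144 by simp
  then have e: "\<eta> * of_int P \<le> real e" "real e < \<eta> * of_int P + 1" unfolding e_def by linarith+
  have "\<eta> * of_int P \<le> 1/12 * of_int P" using \<eta> P144 by (intro mult_right_mono) auto
  then have "real e < real t" using e tP t24 by linarith
  then have et: "e < t" by simp
  define c where "c X = real (card (column \<eta> P X))" for X
  have "grid \<eta> P = (SIGMA X:{0..<P}. column \<eta> P X)"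
    by (auto simp: column_def grid_def)
  then have "card (grid \<eta> P) = card (SIGMA X:{0..<P}. column \<eta> P X)" by simp
  also have "\<dots> = (\<Sum>X\<in>{0..<P}. card (column \<eta> P X))"
    by (rule card_SigmaI) auto
  finally have card: "real (card (grid \<eta> P)) = (\<Sum>X\<in>{0..<P}. c X)" by (simp add: c_def)
  \<comment> \<open>\<open>I2\<close> stops e columns early because of the gap of width \<eta>.
    \<open>I3\<close> starts at 3 t + 3 because P < 6 t + 6, so that X \<ge> P / 2 is guaranteed
    only from there on.\<close>
  define I1 I2 I3 I4 where "I1 = {0..<0 + int (2 * t)}"
    and "I2 = {2 * int t..<2 * int t + int (t - e)}"
    and "I3 = {3 * int t + 3..<3 * int t + 3 + int (t - 3)}"
    and "I4 = {4 * int t..<4 * int t + int t}"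
  note I_defs = I1_def I2_def I3_def I4_def
  have disj: "I1 \<inter> I2 = {}" "(I1 \<union> I2) \<inter> I3 = {}" "(I1 \<union> I2 \<union> I3) \<inter> I4 = {}"
    unfolding I_defs using et t24 by auto
  have fin: "finite I1" "finite I2" "finite I3" "finite I4" by (simp_all add: I_defs)
  have "I1 \<union> I2 \<union> I3 \<union> I4 \<subseteq> {0..<P}" unfolding I_defs using tP t24 et by auto
  then have "sum c (I1 \<union> I2 \<union> I3 \<union> I4) \<le> sum c {0..<P}"
    by (intro sum_mono2) (auto simp: c_def)
  then have split: "sum c I1 + sum c I2 + sum c I3 + sum c I4 \<le> real (card (grid \<eta> P))"
    using disj fin by (simp add: card sum.union_disjoint)
  have "(\<Sum>j<2 * t. 3 / 2 * real j) \<le> sum c I1"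
    unfolding I1_def sum_int_interval c_def
  proof (intro sum_mono)
    fix j assume "j \<in> {..<2 * t}"
    then show "3 / 2 * real j \<le> real (card (column \<eta> P (0 + int j)))"
      using column_lower_slope[of "int j" "int t" P \<eta>] tP \<eta> by simp
  qed
  moreover have "(\<Sum>j<2 * t. 3 / 2 * real j) = 3 * (real t)\<^sup>2 - 3 / 2 * real t"
    unfolding sum_distrib_left[symmetric] gauss_sum_lessThan
    by (simp add: power2_eq_square field_simps)
  ultimately have s1: "3 * (real t)\<^sup>2 - 3 / 2 * real t \<le> sum c I1" by simp
  have "(\<Sum>j<t - e. 3 * real t) \<le> sum c I2"
    unfolding I2_def sum_int_interval c_def
  proof (intro sum_mono)
    fix j assume "j \<in> {..<t - e}"
    then have "real j + real e < real t" using et by auto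
    then have "real_of_int (2 * int t + int j) < 3 * real_of_int (int t) - \<eta> * of_int P" using e by simp
    then show "3 * real t \<le> real (card (column \<eta> P (2 * int t + int j)))"
      using column_lower_flat[of "int t" "2 * int t + int j" \<eta> P] tP \<eta> t24 by simp
  qed
  then have s2: "3 * (real t)\<^sup>2 - 3 * real t * real e \<le> sum c I2"
    using et by (simp add: of_nat_diff power2_eq_square algebra_simps)
  have up: "min (6 * real t) (30 * real t - 6 * of_int X) / 2 - 2 \<le> c X"
    if "3 * int t + 3 \<le> X" "X < 5 * int t" for X
  proof -
    have "min (6 * real t) (30 * real t - 6 * of_int X) \<le> min (of_int P) (5 * of_int P - 6 * of_int X)"
      using tP by (intro min.mono) linarith+
    then have "min (6 * real t) (30 * real t - 6 * of_int X) / 2 - 2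
        \<le> min (of_int P) (5 * of_int P - 6 * of_int X) / 2 - 2"
      by (intro diff_right_mono divide_right_mono) auto
    also have "min (of_int P) (5 * of_int P - 6 * real_of_int X) / 2 - 2 \<le> c X"
      unfolding c_def using that tP t24 by (intro column_upper) linarith+
    finally show ?thesis .
  qed
  have "(\<Sum>j<t - 3. 3 * real t - 2) \<le> sum c I3"
    unfolding I3_def sum_int_interval
  proof (intro sum_mono)
    fix j assume "j \<in> {..<t - 3}"
    then have "real j \<le> real t - 3" "int j < int t - 3" by auto
    then show "3 * real t - 2 \<le> c (3 * int t + 3 + int j)"
      using up[of "3 * int t + 3 + int j"] by (simp add: min_def split: if_splits)
  qed
  then have s3: "3 * (real t)\<^sup>2 - 11 * real t + 6 \<le> sum c I3"
    using t24 by (simp add: of_nat_diff power2_eq_square algebra_simps)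
  have "(\<Sum>j<t. (3 * real t - 2) - 3 * real j) \<le> sum c I4"
    unfolding I4_def sum_int_interval
  proof (intro sum_mono)
    fix j assume "j \<in> {..<t}"
    then have "real j < real t" "int j < int t" by auto
    then show "(3 * real t - 2) - 3 * real j \<le> c (4 * int t + int j)"
      using up[of "4 * int t + int j"] t24
      by (simp add: min_def diff_divide_distrib split: if_splits)
  qed
  moreover have "(\<Sum>j<t. (3 * real t - 2) - 3 * real j) = 3 / 2 * (real t)\<^sup>2 - real t / 2"
    unfolding sum_subtractf sum_distrib_left[symmetric] gauss_sum_lessThan
    by (simp add: power2_eq_square field_simps)
  ultimately have s4: "3 / 2 * (real t)\<^sup>2 - real t / 2 \<le> sum c I4" by simp
  define p where "p = real_of_int P"
  have p: "6 * real t \<le> p" "p \<le> 6 * real t + 5" "p \<ge> 144" unfolding p_def using tP P144 by linarith+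
  have "((p - 5) / 6)\<^sup>2 \<le> (real t)\<^sup>2" using p by (intro power_mono) auto
  then have t2: "36 * (real t)\<^sup>2 \<ge> p\<^sup>2 - 10 * p" by (simp add: power2_eq_square field_simps)
  have "real t * real e \<le> p / 6 * (\<eta> * p + 1)" using p e by (intro mult_mono) (auto simp: p_def)
  then have te: "6 * (real t * real e) \<le> \<eta> * p\<^sup>2 + p" by (simp add: power2_eq_square algebra_simps)
  have "12 \<le> \<eta> * p" using P \<eta> by (simp add: p_def field_simps)
  then have "12 * p \<le> \<eta> * p * p" using p by (intro mult_right_mono) auto
  \<comment> \<open>Half of the allowance \<eta> p^2 pays for the gap; the other half is at least 6
    p and covers all errors linear in p.\<close>
  then have "12 * p \<le> \<eta> * p\<^sup>2" by (simp add: power2_eq_square)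
  moreover have "21 / 2 * (real t)\<^sup>2 - 13 * real t - 3 * (real t * real e) \<le> real (card (grid \<eta> P))"
    using s1 s2 s3 s4 split by (simp add: mult.assoc)
  moreover have "(7/24 - \<eta>) * p\<^sup>2 = 7/24 * p\<^sup>2 - \<eta> * p\<^sup>2" by (simp add: algebra_simps)
  ultimately have "(7/24 - \<eta>) * p\<^sup>2 \<le> real (card (grid \<eta> P))" using t2 te p by linarith
  then show ?thesis by (simp add: p_def)
qed

section \<open>Lifting to the integers\<close>

lemma r3_ge_card:
  assumes "A \<subseteq> {1..N}" "three_AP_free A"
  shows "card A \<le> r3 N"
proof -
  have "{card A | A. A \<subseteq> {1..N} \<and> three_AP_free A} \<subseteq> card ` Pow {1..N}" by blast
  then have "finite {card A | A. A \<subseteq> {1..N} \<and> three_AP_free A}"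
    by (rule finite_subset) auto
  then show ?thesis unfolding r3_def by (rule Max_ge) (use assms in blast)
qed

text \<open>At most M / \<delta> + 1 bins of width \<delta> cover the range of F, and the fullest
  bin is at least average.\<close>

lemma pigeonhole_slab:
  fixes F :: "'a \<Rightarrow> real"
  assumes "finite X" "\<And>x. x \<in> X \<Longrightarrow> 0 \<le> F x \<and> F x \<le> M" "\<delta> > 0" "M \<ge> 0"
  obtains s where "real (card X) \<le> (M / \<delta> + 1) * card {x \<in> X. s \<le> F x \<and> F x < s + \<delta>}"
proof -
  define J where "J = nat \<lfloor>M / \<delta>\<rfloor>"
  define bin where "bin j = {x \<in> X. real j * \<delta> \<le> F x \<and> F x < real j * \<delta> + \<delta>}" for j :: nat
  have "X \<subseteq> (\<Union>j\<in>{..J}. bin j)"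
  proof
    fix x assume x: "x \<in> X"
    define j where "j = nat \<lfloor>F x / \<delta>\<rfloor>"
    have F: "0 \<le> F x / \<delta>" "F x / \<delta> \<le> M / \<delta>" using assms x by (auto simp: divide_right_mono)
    then have "j \<le> J" unfolding j_def J_def by (intro nat_mono floor_mono)
    moreover have "real j = of_int \<lfloor>F x / \<delta>\<rfloor>" unfolding j_def using F by simp
    then have "real j \<le> F x / \<delta>" "F x / \<delta> < real j + 1" by linarith+
    then have "x \<in> bin j" using x assms(3) by (simp add: bin_def field_simps)
    ultimately show "x \<in> (\<Union>j\<in>{..J}. bin j)" by auto
  qed
  then have "card X \<le> card (\<Union>j\<in>{..J}. bin j)"
    using assms(1) by (intro card_mono) (auto simp: bin_def)
  also have "\<dots> \<le> (\<Sum>j\<in>{..J}. card (bin j))" by (rule card_UN_le) simp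
  finally have sum: "card X \<le> (\<Sum>j\<in>{..J}. card (bin j))" .
  have "Max ((\<lambda>j. card (bin j)) ` {..J}) \<in> (\<lambda>j. card (bin j)) ` {..J}" by (intro Max_in) auto
  then obtain i where "card (bin i) = Max ((\<lambda>j. card (bin j)) ` {..J})" by (metis imageE)
  then have i: "card (bin j) \<le> card (bin i)" if "j \<in> {..J}" for j using that by simp
  have "(\<Sum>j\<in>{..J}. card (bin j)) \<le> (\<Sum>j\<in>{..J}. card (bin i))" by (intro sum_mono i)
  also have "\<dots> = (J + 1) * card (bin i)" by simp
  finally have "card X \<le> (J + 1) * card (bin i)" using sum by linarith
  then have "real (card X) \<le> real (J + 1) * card (bin i)" by (metis of_nat_le_iff of_nat_mult)
  also have "real (J + 1) \<le> M / \<delta> + 1" using assms unfolding J_def by simp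
  then have "real (J + 1) * card (bin i) \<le> (M / \<delta> + 1) * card (bin i)"
    by (intro mult_right_mono) auto
  finally show ?thesis using that[of "real i * \<delta>"] by (simp add: bin_def)
qed

section \<open>Affine maps modulo a prime and residues near zero\<close>

lemma inj_on_affine_mod:
  fixes P a :: int
  assumes "coprime a P"
  shows "inj_on (\<lambda>x. (x * a + b) mod P) {0..<P}"
proof (rule inj_onI)
  fix x y assume xy: "x \<in> {0..<P}" "y \<in> {0..<P}" and "(x * a + b) mod P = (y * a + b) mod P"
  then have "[x * a + b = y * a + b] (mod P)" by (simp add: Cong.cong_def)
  then have "[x = y] (mod P)" using assms by (simp add: cong_add_rcancel cong_mult_rcancel)
  then show "x = y" using xy by (simp add: Cong.cong_def)
qed

text \<open>The interval [-m, m] seen modulo P. The two pieces may overlap, since only an upper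
  bound for the size is used.\<close>

definition near_zero :: "int \<Rightarrow> int \<Rightarrow> int set" where
  "near_zero P m = {0..m} \<union> {P - m..<P}"

lemma card_near_zero: "m \<ge> 0 \<Longrightarrow> card (near_zero P m) \<le> nat (2 * m + 1)"
  unfolding near_zero_def by (rule order_trans[OF card_Un_le]) simp

lemma diff_mod_near_zero:
  assumes "x \<in> {0..<P}" "y \<in> {0..<P}" "\<bar>x - y\<bar> \<le> m"
  shows "(x - y) mod P \<in> near_zero P m"
proof (cases "x \<ge> y")
  case True
  then show ?thesis using assms by (simp add: near_zero_def)
next
  case False
  then have "(x - y + P) mod P = x - y + P" using assms by (intro mod_pos_pos_trivial) auto
  then show ?thesis using assms False by (auto simp: near_zero_def)
qed

text \<open>One two-dimensional block of n \<mapsto> \<alpha> n + \<beta>; k blocks with independent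
  parameters form the map into dimension 2 k.\<close>

definition affine_point :: "int \<Rightarrow> int \<times> int \<Rightarrow> int \<times> int \<Rightarrow> int \<Rightarrow> int \<times> int" where
  "affine_point P a b n = ((fst a * n + fst b) mod P, (snd a * n + snd b) mod P)"

definition residue_pairs :: "int \<Rightarrow> (int \<times> int) set" where
  "residue_pairs P = {0..<P} \<times> {0..<P}"

lemma finite_residue_pairs [simp]: "finite (residue_pairs P)"
  by (simp add: residue_pairs_def)

lemma card_residue_pairs: "P > 0 \<Longrightarrow> card (residue_pairs P) = nat P ^ 2"
  by (simp add: residue_pairs_def card_cartesian_product power2_eq_square)

lemma affine_point_in: "P > 0 \<Longrightarrow> affine_point P a b n \<in> residue_pairs P"
  by (simp add: affine_point_def residue_pairs_def)

lemma inj_on_affine_point: "inj_on (\<lambda>b. affine_point P a b n) (residue_pairs P)"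
proof (rule inj_onI)
  fix b b' assume *: "b \<in> residue_pairs P" "b' \<in> residue_pairs P"
    "affine_point P a b n = affine_point P a b' n"
  have "[fst b = fst b'] (mod P)" "[snd b = snd b'] (mod P)"
    using *(3) by (auto simp: affine_point_def Cong.cong_def[symmetric] cong_add_lcancel)
  then show "b = b'" using *(1,2) by (auto simp: residue_pairs_def Cong.cong_def)
qed

lemma card_filter_preimage:
  assumes "inj_on g Y" "g ` Y = Y" "T \<subseteq> Y"
  shows "card {y \<in> Y. g y \<in> T} = card T"
proof -
  have "T \<subseteq> g ` Y" using assms(2,3) by simp
  then have "g ` {y \<in> Y. g y \<in> T} = T" by blast
  moreover have "inj_on g {y \<in> Y. g y \<in> T}" using assms(1) by (rule inj_on_subset) blast
  ultimately show ?thesis by (metis card_image)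
qed

text \<open>For fixed \<alpha> and n, varying \<beta> translates the torus bijectively. Thus the
  image of n is uniformly distributed when \<beta> is.\<close>

lemma card_shift_preimage:
  fixes P n :: int
  assumes P: "P > 0" and T: "T \<subseteq> (\<Pi>\<^sub>E i\<in>{..<k::nat}. residue_pairs P)"
  shows "card {\<beta> \<in> (\<Pi>\<^sub>E i\<in>{..<k}. residue_pairs P).
    (\<lambda>i\<in>{..<k}. affine_point P (\<alpha> i) (\<beta> i) n) \<in> T} = card T" (is "card ?X = _")
proof -
  let ?\<Omega> = "\<Pi>\<^sub>E i\<in>{..<k}. residue_pairs P"
  let ?g = "\<lambda>\<beta>. \<lambda>i\<in>{..<k}. affine_point P (\<alpha> i) (\<beta> i) n"
  have fin: "finite ?\<Omega>" by (intro finite_PiE) auto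
  have maps: "?g ` ?\<Omega> \<subseteq> ?\<Omega>"
    by (rule image_subsetI, rule restrict_PiE_iff[THEN iffD2], rule ballI, rule affine_point_in[OF P])
  have inj: "inj_on ?g ?\<Omega>"
  proof (rule inj_onI)
    fix \<beta> \<beta>' assume b: "\<beta> \<in> ?\<Omega>" "\<beta>' \<in> ?\<Omega>" and eq: "?g \<beta> = ?g \<beta>'"
    show "\<beta> = \<beta>'"
    proof (rule PiE_ext[OF b])
      fix i assume i: "i \<in> {..<k}"
      have "affine_point P (\<alpha> i) (\<beta> i) n = affine_point P (\<alpha> i) (\<beta>' i) n"
        using fun_cong[OF eq, of i] i by simp
      then show "\<beta> i = \<beta>' i"
        by (rule inj_onD[OF inj_on_affine_point _ PiE_mem[OF b(1) i] PiE_mem[OF b(2) i]])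
    qed
  qed
  have "?g ` ?\<Omega> = ?\<Omega>" by (rule endo_inj_surj[OF fin maps inj])
  then show ?thesis by (rule card_filter_preimage[OF inj _ T])
qed

text \<open>Multiplication by d is injective modulo P, so each of the 2 k coordinates of \<alpha>
  has at most 2 m + 1 admissible values.\<close>

lemma card_close_directions:
  fixes P d :: int
  assumes "coprime d P" "m \<ge> 0" "P > 0"
  shows "card {\<alpha> \<in> (\<Pi>\<^sub>E i\<in>{..<k::nat}. residue_pairs P). \<forall>i<k.
    (fst (\<alpha> i) * d) mod P \<in> near_zero P m \<and> (snd (\<alpha> i) * d) mod P \<in> near_zero P m}
    \<le> nat (2 * m + 1) ^ (2 * k)" (is "card ?X \<le> _")
proof -
  define R where "R = {a \<in> {0..<P}. (a * d) mod P \<in> near_zero P m}"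
  have "card R \<le> card (near_zero P m)"
    using inj_on_affine_mod[OF assms(1), of 0]
    by (intro card_inj_on_le[where f = "\<lambda>a. (a * d) mod P"])
      (auto simp: R_def near_zero_def intro: inj_on_subset)
  then have R: "card R \<le> nat (2 * m + 1)" using card_near_zero[OF assms(2), of P] by linarith
  have R_iff: "a \<in> residue_pairs P \<and> (fst a * d) mod P \<in> near_zero P m \<and>
      (snd a * d) mod P \<in> near_zero P m \<longleftrightarrow> a \<in> R \<times> R" for a
    unfolding R_def residue_pairs_def mem_Times_iff by blast
  have "?X = (\<Pi>\<^sub>E i\<in>{..<k}. R \<times> R)"
    by (rule set_eqI) (simp only: mem_Collect_eq PiE_iff R_iff[symmetric] lessThan_iff Ball_def, blast)
  then have "card ?X = card (R \<times> R) ^ k" by (simp add: card_PiE)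
  also have "\<dots> = card R ^ (2 * k)"
    by (simp add: card_cartesian_product power_mult power2_eq_square)
  also have "\<dots> \<le> nat (2 * m + 1) ^ (2 * k)" by (rule power_mono[OF R]) simp
  finally show ?thesis .
qed

section \<open>Progressions inside a slab\<close>

lemma cong_midpoint_affine:
  fixes P :: int
  assumes "x + z = 2 * y"
  shows "[(a * x + b) mod P + (a * z + b) mod P = 2 * ((a * y + b) mod P)] (mod P)"
proof -
  have "a * x + b + (a * z + b) = 2 * (a * y + b)"
    using arg_cong[OF assms, of "\<lambda>t. a * t"] by (simp add: algebra_simps)
  moreover have "[(a * x + b) mod P + (a * z + b) mod P = (a * x + b) + (a * z + b)] (mod P)"
    by (intro cong_add) (simp_all add: Cong.cong_def)
  moreover have "[2 * (a * y + b) = 2 * ((a * y + b) mod P)] (mod P)"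
    by (intro cong_mult) (simp_all add: Cong.cong_def)
  ultimately show ?thesis by (metis cong_trans)
qed

lemma sum_le_imp_term_le:
  fixes g :: "'a \<Rightarrow> real"
  assumes "finite I" "\<And>i. i \<in> I \<Longrightarrow> g i \<ge> 0" "sum g I \<le> C" "i \<in> I"
  shows "g i \<le> C"
proof -
  have "g i \<le> sum g I" using assms by (intro member_le_sum) auto
  then show ?thesis using assms(3) by linarith
qed

text \<open>The gains of the k blocks are nonnegative, and the slab bounds their sum by 2 (s +
  \<delta>) - 2 s = 2 \<delta>. So each single gain is at most 2 \<delta>, the outer images are
  m-close in every block, and \<alpha> times the difference of the outer terms is near zero
  everywhere, which \<open>apart\<close> forbids.\<close>

lemma slab_three_AP_free:
  fixes f :: "int \<times> int \<Rightarrow> real" and P m :: int and k :: nat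
  assumes gain: "\<And>p q r. p \<in> S \<Longrightarrow> q \<in> S \<Longrightarrow> r \<in> S \<Longrightarrow>
      [fst p + fst r = 2 * fst q] (mod P) \<Longrightarrow> [snd p + snd r = 2 * snd q] (mod P) \<Longrightarrow>
      0 \<le> f p + f r - 2 * f q \<and>
      (f p + f r - 2 * f q \<le> 2 * \<delta> \<longrightarrow> \<bar>fst p - fst r\<bar> \<le> m \<and> \<bar>snd p - snd r\<bar> \<le> m)"
    and S: "S \<subseteq> residue_pairs P"
    and A: "\<And>n i. n \<in> A \<Longrightarrow> i < k \<Longrightarrow> affine_point P (\<alpha> i) (\<beta> i) (int n) \<in> S"
    and slab: "\<And>n. n \<in> A \<Longrightarrow> s \<le> (\<Sum>i<k. f (affine_point P (\<alpha> i) (\<beta> i) (int n))) \<and>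
        (\<Sum>i<k. f (affine_point P (\<alpha> i) (\<beta> i) (int n))) < s + \<delta>"
    and apart: "\<And>n l. n \<in> A \<Longrightarrow> l \<in> A \<Longrightarrow> n < l \<Longrightarrow>
        \<not> (\<forall>i<k. (fst (\<alpha> i) * (int l - int n)) mod P \<in> near_zero P m \<and>
               (snd (\<alpha> i) * (int l - int n)) mod P \<in> near_zero P m)"
  shows "three_AP_free A"
proof -
  have False if x: "x \<in> A" and y: "y \<in> A" and z: "z \<in> A" and ap: "x + z = 2 * y" and "z < x" for x y z
  proof -
    define g where "g n i = affine_point P (\<alpha> i) (\<beta> i) (int n)" for n :: nat and i
    define G where "G i = f (g x i) + f (g z i) - 2 * f (g y i)" for i
    have ap': "int x + int z = 2 * int y" using ap by linarith
    have G: "0 \<le> G i \<and> (G i \<le> 2 * \<delta> \<longrightarrow>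
        \<bar>fst (g x i) - fst (g z i)\<bar> \<le> m \<and> \<bar>snd (g x i) - snd (g z i)\<bar> \<le> m)" if "i < k" for i
      unfolding G_def
    proof (rule gain)
      show "[fst (g x i) + fst (g z i) = 2 * fst (g y i)] (mod P)"
        "[snd (g x i) + snd (g z i) = 2 * snd (g y i)] (mod P)"
        unfolding g_def affine_point_def using cong_midpoint_affine[OF ap'] by simp_all
    qed (use A x y z that in \<open>auto simp: g_def\<close>)
    have "sum G {..<k} = (\<Sum>i<k. f (g x i)) + (\<Sum>i<k. f (g z i)) - 2 * (\<Sum>i<k. f (g y i))"
      by (simp add: G_def sum.distrib sum_subtractf sum_distrib_left)
    also have "\<dots> \<le> 2 * \<delta>" using slab[OF x] slab[OF y] slab[OF z] unfolding g_def by linarith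
    finally have sum: "sum G {..<k} \<le> 2 * \<delta>" .
    have "(fst (\<alpha> i) * (int x - int z)) mod P \<in> near_zero P m \<and>
        (snd (\<alpha> i) * (int x - int z)) mod P \<in> near_zero P m" if i: "i < k" for i
    proof -
      have "G i \<le> 2 * \<delta>" using G sum i by (intro sum_le_imp_term_le[of "{..<k}" G]) auto
      then have close: "\<bar>fst (g x i) - fst (g z i)\<bar> \<le> m" "\<bar>snd (g x i) - snd (g z i)\<bar> \<le> m"
        using G[OF i] by auto
      have mem: "g x i \<in> residue_pairs P" "g z i \<in> residue_pairs P"
        using A S x z i by (auto simp: g_def)
      have "(fst (g x i) - fst (g z i)) mod P \<in> near_zero P m"
        "(snd (g x i) - snd (g z i)) mod P \<in> near_zero P m"
        using mem close by (auto simp: residue_pairs_def mem_Times_iff intro!: diff_mod_near_zero)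
      then show ?thesis
        by (simp add: g_def affine_point_def mod_simps right_diff_distrib)
    qed
    then show False using apart[OF z x \<open>z < x\<close>] by blast
  qed
  \<comment> \<open>Reversing a progression swaps x and z, so z < x is no restriction.\<close>
  then show ?thesis unfolding three_AP_free_def
    by (metis add.commute linorder_neqE_nat)
qed

section \<open>Averaging over the random affine maps\<close>

lemma sum_card_filter_swap:
  assumes "finite A" "finite B"
  shows "(\<Sum>b\<in>B. card {a \<in> A. R a b}) = (\<Sum>a\<in>A. card {b \<in> B. R a b})"
proof -
  have "(\<Sum>b\<in>B. card {a \<in> A. R a b}) = (\<Sum>b\<in>B. \<Sum>a\<in>A. if R a b then 1 else 0)"
    by (simp only: card_eq_sum sum.inter_filter[OF assms(1)])
  also have "\<dots> = (\<Sum>a\<in>A. \<Sum>b\<in>B. if R a b then 1 else 0)" by (rule sum.swap)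
  also have "\<dots> = (\<Sum>a\<in>A. card {b \<in> B. R a b})"
    by (simp only: card_eq_sum sum.inter_filter[OF assms(2)])
  finally show ?thesis .
qed

lemma exists_ge_average:
  fixes g :: "'a \<Rightarrow> real"
  assumes "finite B" "B \<noteq> {}" "real (card B) * c \<le> sum g B"
  shows "\<exists>x\<in>B. c \<le> g x"
proof (rule ccontr)
  assume "\<not> ?thesis"
  then have "sum g B < (\<Sum>x\<in>B. c)" using assms by (intro sum_strict_mono) auto
  then show False using assms by simp
qed

text \<open>With W parameters each for \<alpha> and \<beta>, the mean number of points sent into the
  slab T is N |T| / W. The mean number of bad pairs is at most N^2 Q |T| / W^2, which hypothesis
  \<open>m\<close> makes at most half of that. Some choice therefore keeps N |T| / (2 W) points
  after deleting one point per bad pair.\<close>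

lemma r3_lower_bound_lift:
  fixes f :: "int \<times> int \<Rightarrow> real" and P m :: int and k N :: nat
  assumes P: "prime P" "int N < P" and S: "S \<subseteq> residue_pairs P"
    and gain: "\<And>p q r. p \<in> S \<Longrightarrow> q \<in> S \<Longrightarrow> r \<in> S \<Longrightarrow>
      [fst p + fst r = 2 * fst q] (mod P) \<Longrightarrow> [snd p + snd r = 2 * snd q] (mod P) \<Longrightarrow>
      0 \<le> f p + f r - 2 * f q \<and>
      (f p + f r - 2 * f q \<le> 2 * \<delta> \<longrightarrow> \<bar>fst p - fst r\<bar> \<le> m \<and> \<bar>snd p - snd r\<bar> \<le> m)"
    and f: "\<And>p. p \<in> S \<Longrightarrow> 0 \<le> f p \<and> f p \<le> M" and "\<delta> > 0" "M \<ge> 0" "m \<ge> 0"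
    and m: "2 * real N * (2 * real_of_int m + 1) ^ (2 * k) \<le> real_of_int P ^ (2 * k)"
  shows "real N * real (card S) ^ k \<le>
    2 * real_of_int P ^ (2 * k) * (real k * M / \<delta> + 1) * real (r3 N)"
proof -
  have P0: "P > 0" using P(1) by (rule prime_gt_0_int)
  define \<Omega> where "\<Omega> = (\<Pi>\<^sub>E i\<in>{..<k}. residue_pairs P)"
  have fin\<Omega> [simp]: "finite \<Omega>" unfolding \<Omega>_def by (intro finite_PiE) auto
  define W where "W = card \<Omega>"
  have "W = nat P ^ (2 * k)"
    unfolding W_def \<Omega>_def by (simp add: card_PiE card_residue_pairs[OF P0] power_mult)
  then have W: "real W = real_of_int P ^ (2 * k)" using P0 by simp
  then have W0: "real W > 0" using P0 by simp
  define X where "X = (\<Pi>\<^sub>E i\<in>{..<k}. S)"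
  have finS: "finite S" using S by (rule finite_subset) simp
  then have finX: "finite X" unfolding X_def by (intro finite_PiE) auto
  have cardX: "card X = card S ^ k" by (simp add: X_def card_PiE)
  define F where "F p = (\<Sum>i<k. f (p i))" for p :: "nat \<Rightarrow> int \<times> int"
  have F: "0 \<le> F p \<and> F p \<le> real k * M" if p: "p \<in> X" for p
  proof -
    have fp: "0 \<le> f (p i)" "f (p i) \<le> M" if "i \<in> {..<k}" for i
      using f[OF PiE_mem[OF p[unfolded X_def] that]] by auto
    have "0 \<le> F p" unfolding F_def by (rule sum_nonneg[OF fp(1)])
    moreover have "F p \<le> (\<Sum>i<k. M)" unfolding F_def by (rule sum_mono[OF fp(2)])
    ultimately show ?thesis by simp
  qed
  obtain s where s: "real (card X) \<le> (real k * M / \<delta> + 1) * card {p \<in> X. s \<le> F p \<and> F p < s + \<delta>}"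
    by (rule pigeonhole_slab[OF finX F \<open>\<delta> > 0\<close>]) (simp_all add: \<open>M \<ge> 0\<close>)
  define T where "T = {p \<in> X. s \<le> F p \<and> F p < s + \<delta>}"
  have "X \<subseteq> \<Omega>" unfolding X_def \<Omega>_def using S by (intro PiE_mono)
  moreover have "T \<subseteq> X" unfolding T_def by (rule Collect_restrict)
  ultimately have T\<Omega>: "T \<subseteq> \<Omega>" by (metis subset_trans)
  define \<phi> where "\<phi> \<alpha> \<beta> n = (\<lambda>i\<in>{..<k}. affine_point P (\<alpha> i) (\<beta> i) (int n))" for \<alpha> \<beta> and n :: nat
  have shift: "card {\<beta> \<in> \<Omega>. \<phi> \<alpha> \<beta> n \<in> T} = card T" for \<alpha> n
    unfolding \<phi>_def \<Omega>_def by (rule card_shift_preimage[OF P0 T\<Omega>[unfolded \<Omega>_def]])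
  define close where "close \<alpha> pr \<longleftrightarrow> (\<forall>i<k.
      (fst (\<alpha> i) * (int (snd pr) - int (fst pr))) mod P \<in> near_zero P m \<and>
      (snd (\<alpha> i) * (int (snd pr) - int (fst pr))) mod P \<in> near_zero P m)"
    for \<alpha> :: "nat \<Rightarrow> int \<times> int" and pr :: "nat \<times> nat"
  define D where "D = {pr \<in> {1..N} \<times> {1..N}. fst pr < snd pr}"
  have finD [simp]: "finite D" by (simp add: D_def)
  have "card D \<le> card ({1..N} \<times> {1..N})" unfolding D_def by (intro card_mono) auto
  then have cardD: "card D \<le> N * N" by (simp add: card_cartesian_product)
  define A where "A \<alpha> \<beta> = {n \<in> {1..N}. \<phi> \<alpha> \<beta> n \<in> T}" for \<alpha> \<beta>
  \<comment> \<open>Only the smaller point of a pair is required to land in T. Closeness depends on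
    \<alpha> alone, and for fixed \<alpha> the landing condition is uniform in \<beta>, so the count
    factors.\<close>
  define E where "E \<alpha> \<beta> = {pr \<in> D. close \<alpha> pr \<and> \<phi> \<alpha> \<beta> (fst pr) \<in> T}" for \<alpha> \<beta>
  have "(\<Sum>\<beta>\<in>\<Omega>. card (A \<alpha> \<beta>)) = N * card T" for \<alpha>
    unfolding A_def by (subst sum_card_filter_swap) (simp_all add: shift)
  then have sumA: "(\<Sum>\<alpha>\<in>\<Omega>. \<Sum>\<beta>\<in>\<Omega>. card (A \<alpha> \<beta>)) = W * (N * card T)" by (simp add: W_def)
  define Q where "Q = nat (2 * m + 1) ^ (2 * k)"
  have "(\<Sum>\<beta>\<in>\<Omega>. card (E \<alpha> \<beta>)) = card {pr \<in> D. close \<alpha> pr} * card T" for \<alpha>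
  proof -
    have "(\<Sum>\<beta>\<in>\<Omega>. card (E \<alpha> \<beta>)) = (\<Sum>pr\<in>D. card {\<beta> \<in> \<Omega>. close \<alpha> pr \<and> \<phi> \<alpha> \<beta> (fst pr) \<in> T})"
      unfolding E_def by (rule sum_card_filter_swap) simp_all
    also have "\<dots> = (\<Sum>pr\<in>D. if close \<alpha> pr then card T else 0)"
      by (intro sum.cong refl) (simp add: shift)
    also have "\<dots> = card {pr \<in> D. close \<alpha> pr} * card T"
      by (simp add: sum.inter_filter[symmetric])
    finally show ?thesis .
  qed
  then have "(\<Sum>\<alpha>\<in>\<Omega>. \<Sum>\<beta>\<in>\<Omega>. card (E \<alpha> \<beta>)) = (\<Sum>\<alpha>\<in>\<Omega>. card {pr \<in> D. close \<alpha> pr}) * card T"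
    by (simp add: sum_distrib_right)
  also have "(\<Sum>\<alpha>\<in>\<Omega>. card {pr \<in> D. close \<alpha> pr}) = (\<Sum>pr\<in>D. card {\<alpha> \<in> \<Omega>. close \<alpha> pr})"
    by (rule sum_card_filter_swap) simp_all
  also have "\<dots> \<le> (\<Sum>pr\<in>D. Q)"
  proof (intro sum_mono)
    fix pr assume pr: "pr \<in> D"
    let ?d = "int (snd pr) - int (fst pr)"
    \<comment> \<open>This is where P has to be a prime larger than N: every difference is
      invertible modulo P.\<close>
    have "0 < ?d" "?d < P" using pr P(2) by (auto simp: D_def)
    then have "\<not> P dvd ?d" by (auto dest: zdvd_imp_le)
    then have "coprime ?d P" using P(1) by (simp add: prime_imp_coprime coprime_commute)
    then show "card {\<alpha> \<in> \<Omega>. close \<alpha> pr} \<le> Q"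
      unfolding \<Omega>_def close_def Q_def using \<open>m \<ge> 0\<close> P0 by (rule card_close_directions)
  qed
  also have "(\<Sum>pr\<in>D. Q) \<le> N * N * Q" using cardD by simp
  finally have sumE: "(\<Sum>\<alpha>\<in>\<Omega>. \<Sum>\<beta>\<in>\<Omega>. card (E \<alpha> \<beta>)) \<le> N * N * Q * card T" by simp
  have "real Q = (2 * real_of_int m + 1) ^ (2 * k)" unfolding Q_def using \<open>m \<ge> 0\<close> by simp
  then have NQ: "2 * (real N * real Q) \<le> real W" using m W by simp
  \<comment> \<open>Half the mean of \<open>card (A \<alpha> \<beta>)\<close>.\<close>
  define c where "c = real N * real (card T) / (2 * real W)"
  have "real W * real W * c = real W * (real N * card T) - real W / 2 * (real N * card T)"
    unfolding c_def using W0 by (simp add: field_simps)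
  also have "\<dots> \<le> real W * (real N * card T) - real N * real Q * (real N * card T)"
    using NQ by (intro diff_left_mono mult_right_mono) auto
  also have "\<dots> \<le> real (\<Sum>\<alpha>\<in>\<Omega>. \<Sum>\<beta>\<in>\<Omega>. card (A \<alpha> \<beta>)) - real (\<Sum>\<alpha>\<in>\<Omega>. \<Sum>\<beta>\<in>\<Omega>. card (E \<alpha> \<beta>))"
  proof -
    have "real (\<Sum>\<alpha>\<in>\<Omega>. \<Sum>\<beta>\<in>\<Omega>. card (E \<alpha> \<beta>)) \<le> real (N * N * Q * card T)"
      using sumE by (simp only: of_nat_le_iff)
    then show ?thesis unfolding sumA by (simp add: mult_ac)
  qed
  also have "\<dots> = (\<Sum>ab\<in>\<Omega>\<times>\<Omega>. real (card (A (fst ab) (snd ab))) - real (card (E (fst ab) (snd ab))))"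
    by (simp add: sum.cartesian_product sum_subtractf case_prod_beta)
  finally have "real (card (\<Omega> \<times> \<Omega>)) * c \<le>
      (\<Sum>ab\<in>\<Omega>\<times>\<Omega>. real (card (A (fst ab) (snd ab))) - real (card (E (fst ab) (snd ab))))"
    by (simp add: card_cartesian_product W_def)
  moreover have "\<Omega> \<noteq> {}" using W0 by (auto simp: W_def)
  ultimately obtain \<alpha> \<beta> where c: "c \<le> real (card (A \<alpha> \<beta>)) - real (card (E \<alpha> \<beta>))"
    using exists_ge_average[of "\<Omega> \<times> \<Omega>" c
        "\<lambda>ab. real (card (A (fst ab) (snd ab))) - real (card (E (fst ab) (snd ab)))"]
    by auto
  \<comment> \<open>Deleting first components removes the smaller point of every bad pair.\<close>
  define A' where "A' = A \<alpha> \<beta> - fst ` E \<alpha> \<beta>"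
  have mem: "\<phi> \<alpha> \<beta> n \<in> T" if "n \<in> A'" for n using that by (auto simp: A'_def A_def)
  have "three_AP_free A'"
  proof (rule slab_three_AP_free[where P = P and m = m and k = k and S = S and f = f
        and \<alpha> = \<alpha> and \<beta> = \<beta> and s = s and \<delta> = \<delta>, OF gain S])
    fix n i assume "n \<in> A'" "i < k"
    then have "\<phi> \<alpha> \<beta> n \<in> X" "i \<in> {..<k}" using mem[of n] by (auto simp: T_def)
    then have "\<phi> \<alpha> \<beta> n i \<in> S" unfolding X_def by (rule PiE_mem)
    then show "affine_point P (\<alpha> i) (\<beta> i) (int n) \<in> S" using \<open>i < k\<close> by (simp add: \<phi>_def)
  next
    fix n assume "n \<in> A'"
    then have "s \<le> F (\<phi> \<alpha> \<beta> n) \<and> F (\<phi> \<alpha> \<beta> n) < s + \<delta>" using mem[of n] by (simp add: T_def)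
    moreover have "F (\<phi> \<alpha> \<beta> n) = (\<Sum>i<k. f (affine_point P (\<alpha> i) (\<beta> i) (int n)))"
      unfolding F_def \<phi>_def by (intro sum.cong) auto
    ultimately show "s \<le> (\<Sum>i<k. f (affine_point P (\<alpha> i) (\<beta> i) (int n))) \<and>
        (\<Sum>i<k. f (affine_point P (\<alpha> i) (\<beta> i) (int n))) < s + \<delta>" by simp
  next
    fix n l assume nl: "n \<in> A'" "l \<in> A'" "n < l"
    have "\<not> close \<alpha> (n, l)"
    proof
      assume "close \<alpha> (n, l)"
      then have "(n, l) \<in> E \<alpha> \<beta>" using nl mem[of n] by (auto simp: E_def D_def A'_def A_def)
      then show False using nl(1) by (force simp: A'_def)
    qed
    then show "\<not> (\<forall>i<k. (fst (\<alpha> i) * (int l - int n)) mod P \<in> near_zero P m \<and>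
               (snd (\<alpha> i) * (int l - int n)) mod P \<in> near_zero P m)"
      by (simp add: close_def)
  qed
  moreover have "A' \<subseteq> {1..N}" by (auto simp: A'_def A_def)
  ultimately have "card A' \<le> r3 N" by (intro r3_ge_card)
  moreover have "card (A \<alpha> \<beta>) - card (fst ` E \<alpha> \<beta>) \<le> card A'"
    unfolding A'_def by (rule diff_card_le_card_Diff) (simp add: E_def)
  moreover have "card (fst ` E \<alpha> \<beta>) \<le> card (E \<alpha> \<beta>)" by (rule card_image_le) (simp add: E_def)
  ultimately have "c \<le> real (r3 N)" using c by linarith
  then have cT: "real N * real (card T) \<le> 2 * real W * real (r3 N)"
    unfolding c_def using W0 by (simp add: field_simps)
  have K: "real k * M / \<delta> + 1 \<ge> 0" using \<open>M \<ge> 0\<close> \<open>\<delta> > 0\<close> by simp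
  have "real N * real (card S) ^ k \<le> real N * ((real k * M / \<delta> + 1) * card T)"
    using s cardX by (intro mult_left_mono) (auto simp: T_def)
  also have "\<dots> \<le> (real k * M / \<delta> + 1) * (2 * real W * real (r3 N))"
    using mult_left_mono[OF cT K] by (simp add: mult_ac)
  finally show ?thesis unfolding W by (simp add: mult_ac)
qed

section \<open>Optimizing the dimension\<close>

definition scaled_height :: "real \<Rightarrow> int \<Rightarrow> int \<times> int \<Rightarrow> real" where
  "scaled_height \<eta> P p = height \<eta> (of_int (fst p) / of_int P, of_int (snd p) / of_int P)"

lemma cong_midpoint_Ints:
  fixes P :: int
  assumes "[x + z = 2 * y] (mod P)" "P > 0"
  shows "of_int x / of_int P + of_int z / of_int P - 2 * (of_int y / of_int P) \<in> (\<int> :: real set)"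
proof -
  obtain q where "x + z - 2 * y = P * q" using assms(1) by (auto simp: cong_iff_dvd_diff dvd_def)
  then have "real_of_int (x + z - 2 * y) = of_int (P * q)" by (simp only:)
  then have "of_int x / of_int P + of_int z / of_int P - 2 * (of_int y / of_int P) = real_of_int q"
    using assms(2) by (simp add: field_simps)
  then show ?thesis by simp
qed

text \<open>With slab width \<rho>^2 / 4 the gain is at most \<rho>^2 / 2. As it is at least d^2 /
  2, each coordinate difference is at most \<rho> on the torus, that is \<rho> P on the
  grid.\<close>

lemma scaled_height_gain:
  assumes pqr: "p \<in> grid \<eta> P" "q \<in> grid \<eta> P" "r \<in> grid \<eta> P"
    and "[fst p + fst r = 2 * fst q] (mod P)" "[snd p + snd r = 2 * snd q] (mod P)"
    and \<eta>: "0 < \<eta>" "\<eta> \<le> 1/4" and P: "P > 0" and \<rho>: "\<rho> > 0"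
  defines "g \<equiv> scaled_height \<eta> P p + scaled_height \<eta> P r - 2 * scaled_height \<eta> P q"
  shows "0 \<le> g \<and> (g \<le> 2 * (\<rho>\<^sup>2 / 4) \<longrightarrow>
    \<bar>fst p - fst r\<bar> \<le> \<lfloor>\<rho> * of_int P\<rfloor> \<and> \<bar>snd p - snd r\<bar> \<le> \<lfloor>\<rho> * of_int P\<rfloor>)"
proof -
  let ?x = "\<lambda>p. of_int (fst p) / of_int P :: real" and ?y = "\<lambda>p. of_int (snd p) / of_int P :: real"
  have gain: "d\<^sup>2 / 2 \<le> g" if "d = \<bar>?x p - ?x r\<bar> \<or> d = \<bar>?y p - ?y r\<bar>" for d
    unfolding g_def scaled_height_def
    by (rule height_gain[OF _ _ _ \<eta> cong_midpoint_Ints cong_midpoint_Ints that])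
      (use pqr assms(4,5) P in \<open>auto simp: grid_def\<close>)
  have close: "\<bar>u - v\<bar> \<le> \<lfloor>\<rho> * of_int P\<rfloor>"
    if g: "g \<le> 2 * (\<rho>\<^sup>2 / 4)" and uv: "\<bar>of_int u / of_int P - of_int v / of_int P\<bar>\<^sup>2 / 2 \<le> g" for u v :: int
  proof -
    have "\<bar>of_int u / of_int P - of_int v / of_int P\<bar>\<^sup>2 \<le> \<rho>\<^sup>2" using g uv by linarith
    then have "\<bar>of_int u / of_int P - of_int v / of_int P\<bar> \<le> \<rho>"
      using \<rho> by (simp only: power_mono_iff abs_ge_zero less_imp_le zero_less_numeral)
    moreover have "\<bar>of_int u / of_int P - of_int v / of_int P\<bar> = of_int \<bar>u - v\<bar> / real_of_int P"
      using P by (simp add: diff_divide_distrib[symmetric] abs_divide)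
    ultimately have "of_int \<bar>u - v\<bar> \<le> \<rho> * of_int P" using P by (simp add: divide_le_eq)
    then show ?thesis by (simp only: le_floor_iff)
  qed
  have "0 \<le> \<bar>?x p - ?x r\<bar>\<^sup>2 / 2" by simp
  then have "0 \<le> g" using gain[of "\<bar>?x p - ?x r\<bar>"] by linarith
  then show ?thesis using close gain by blast
qed

lemma r3_lower_bound:
  fixes N k :: nat
  assumes \<eta>: "0 < \<eta>" "\<eta> \<le> 1/12" and N: "N \<ge> 1" and k: "k \<ge> 1"
  shows "real N * (7/24 - \<eta>) ^ k
    \<le> 1024 * real k * (6 / \<eta>\<^sup>2 + 2) * real N powr (1 / real k) * real (r3 N)"
proof -
  define M where "M = 6 / \<eta>\<^sup>2 + 2"
  have M: "M \<ge> 2" unfolding M_def by simp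
  \<comment> \<open>Chosen so that (8 \<rho>)^(2 k) = 1 / N. Below, 2 m + 1 \<le> 4 \<rho> P, and
    the remaining factor 2^(-2 k) \<le> 1/2 supplies the 2 in the condition on bad pairs.\<close>
  define \<rho> where "\<rho> = real N powr (- 1 / (2 * real k)) / 8"
  have \<rho>: "\<rho> > 0" unfolding \<rho>_def using N by simp
  \<comment> \<open>The three lower bounds serve the grid count, the invertibility of differences,
    and the estimate 2 \<rho> P + 1 \<le> 4 \<rho> P.\<close>
  obtain p :: nat where p: "prime p" "p > nat \<lceil>max (12 / \<eta>) (max (real N) (1 / \<rho>))\<rceil>"
    using bigger_prime by blast
  define P where "P = int p"
  have "max (12 / \<eta>) (max (real N) (1 / \<rho>)) < real p" using p(2) by linarith
  then have P: "12 / \<eta> \<le> of_int P" "int N < P" "1 / \<rho> \<le> of_int P"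
    by (auto simp: P_def)
  have primeP: "prime P" using p(1) by (simp add: P_def)
  then have P0: "P > 0" by (rule prime_gt_0_int)
  define m where "m = \<lfloor>\<rho> * of_int P\<rfloor>"
  have m0: "m \<ge> 0" unfolding m_def using \<rho> P0 by simp
  have "2 * real_of_int m + 1 \<le> 2 * (\<rho> * of_int P) + 1" by (simp add: m_def)
  also have "\<dots> \<le> 4 * \<rho> * of_int P" using P(3) \<rho> by (simp add: field_simps)
  finally have m4: "2 * real_of_int m + 1 \<le> 4 * \<rho> * of_int P" .
  have \<rho>8: "8 * \<rho> = real N powr (- 1 / (2 * real k))" by (simp add: \<rho>_def)
  have "(8 * \<rho>) ^ (2 * k) = (real N powr (- 1 / (2 * real k))) powr real (2 * k)"
    unfolding \<rho>8 by (rule powr_realpow[symmetric]) (use N in simp)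
  also have "\<dots> = real N powr (- 1)"
    unfolding powr_powr by (rule arg_cong[of _ _ "\<lambda>e. real N powr e"]) (use k in simp)
  also have "\<dots> = 1 / real N" using N by (simp add: powr_neg_one)
  finally have \<rho>k: "(8 * \<rho>) ^ (2 * k) = 1 / real N" .
  have "(4 * \<rho>) ^ (2 * k) = (8 * \<rho> / 2) ^ (2 * k)" by simp
  also have "\<dots> = (8 * \<rho>) ^ (2 * k) / 2 ^ (2 * k)" by (rule power_divide)
  also have "\<dots> \<le> (8 * \<rho>) ^ (2 * k) / 2 ^ 1" using k
    by (intro divide_left_mono power_increasing) (auto simp: \<rho>k)
  finally have \<rho>4: "(4 * \<rho>) ^ (2 * k) \<le> 1 / (2 * real N)" unfolding \<rho>k by simp
  have "(2 * real_of_int m + 1) ^ (2 * k) \<le> (4 * \<rho> * of_int P) ^ (2 * k)"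
    using m0 by (intro power_mono m4) auto
  also have "\<dots> = (4 * \<rho>) ^ (2 * k) * of_int P ^ (2 * k)" by (simp add: power_mult_distrib)
  also have "\<dots> \<le> 1 / (2 * real N) * of_int P ^ (2 * k)"
    using P0 by (intro mult_right_mono \<rho>4) auto
  finally have dens: "2 * real N * (2 * real_of_int m + 1) ^ (2 * k) \<le> of_int P ^ (2 * k)"
    using N by (simp add: field_simps)
  define \<delta> where "\<delta> = \<rho>\<^sup>2 / 4"
  have \<delta>0: "\<delta> > 0" unfolding \<delta>_def using \<rho> by simp
  have lift: "real N * real (card (grid \<eta> P)) ^ k \<le>
    2 * real_of_int P ^ (2 * k) * (real k * M / \<delta> + 1) * real (r3 N)"
  proof (rule r3_lower_bound_lift[where f = "scaled_height \<eta> P", OF primeP P(2) _ _ _ \<delta>0 _ m0 dens])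
    show "grid \<eta> P \<subseteq> residue_pairs P" by (auto simp: grid_def residue_pairs_def)
    show "0 \<le> scaled_height \<eta> P p \<and> scaled_height \<eta> P p \<le> M" if "p \<in> grid \<eta> P" for p
      unfolding scaled_height_def M_def
      using that \<eta>(1) height_bounds[of "(of_int (fst p) / of_int P, of_int (snd p) / of_int P)" \<eta>]
      by (auto simp: grid_def)
    show "M \<ge> 0" using M by simp
  qed (use scaled_height_gain[OF _ _ _ _ _ \<eta>(1) _ P0 \<rho>] \<eta>(2) in \<open>auto simp: \<delta>_def m_def\<close>)
  have "(7/24 - \<eta>) ^ k * of_int P ^ (2 * k) = ((7/24 - \<eta>) * (of_int P)\<^sup>2) ^ k"
    by (simp add: power_mult_distrib power_mult)
  also have "\<dots> \<le> real (card (grid \<eta> P)) ^ k"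
    using \<eta> by (intro power_mono card_grid_ge[OF \<eta> P(1)]) auto
  finally have "real N * ((7/24 - \<eta>) ^ k * of_int P ^ (2 * k)) \<le> real N * real (card (grid \<eta> P)) ^ k"
    by (intro mult_left_mono) auto
  from order_trans[OF this lift]
  have "of_int P ^ (2 * k) * (real N * (7/24 - \<eta>) ^ k)
    \<le> of_int P ^ (2 * k) * (2 * (real k * M / \<delta> + 1) * real (r3 N))"
    by (simp only: mult_ac)
  then have main: "real N * (7/24 - \<eta>) ^ k \<le> 2 * (real k * M / \<delta> + 1) * real (r3 N)"
    by (rule mult_left_le_imp_le) (use P0 in simp)
  have "\<delta> = (real N powr (- 1 / (2 * real k))) powr 2 / 256"
    unfolding \<delta>_def \<rho>_def by (simp add: power_divide)
  also have "(real N powr (- 1 / (2 * real k))) powr 2 = real N powr (- (1 / real k))"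
    by (simp add: powr_powr)
  finally have \<delta>: "1 / \<delta> = 256 * real N powr (1 / real k)"
    by (simp add: powr_minus_divide)
  have "1 \<le> real N powr (1 / real k)" using N by (intro ge_one_powr_ge_zero) auto
  moreover have kM: "1 \<le> real k * M" using mult_mono[of 1 "real k" 1 M] k M by simp
  ultimately have one: "1 \<le> real k * M * (256 * real N powr (1 / real k))"
    using mult_mono[of 1 "real k * M" 1 "256 * real N powr (1 / real k)"] by simp
  have "real k * M / \<delta> = real k * M * (256 * real N powr (1 / real k))"
    unfolding \<delta>[symmetric] by simp
  \<comment> \<open>The constant is 4 * 256: 2 (x + 1) \<le> 4 x for x \<ge> 1, and 1 / \<delta>
    contributes 256.\<close>
  then have "2 * (real k * M / \<delta> + 1) \<le> 1024 * real k * M * real N powr (1 / real k)"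
    using one by (simp add: mult_ac)
  then have "2 * (real k * M / \<delta> + 1) * real (r3 N)
    \<le> 1024 * real k * M * real N powr (1 / real k) * real (r3 N)"
    by (rule mult_right_mono) simp
  then show ?thesis using main unfolding M_def by linarith
qed

section \<open>Balancing density against slab width\<close>

lemma mult_powr_minus_le_iff: "n * 2 powr (- t) \<le> r \<longleftrightarrow> n \<le> r * 2 powr t" for n r t :: real
  by (simp add: powr_minus_divide pos_divide_le_eq)

text \<open>With s = sqrt (log N), the density costs k L in the exponent and the slab costs s^2 / k.
  The sum is least at k = s / sqrt L, where both equal s sqrt L; this is the source of the factor 2
  in \<open>C_const\<close>.\<close>

lemma eventually_r3_ge:
  assumes "\<epsilon> > 0"
  shows "eventually (\<lambda>N. real N * 2 powr (- (C_const + \<epsilon>) * sqrt (log 2 (real N))) \<le> real (r3 N)) sequentially"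
proof -
  define L where "L = log 2 (24 / 7)"
  define l where "l = sqrt L"
  have "L > 0" unfolding L_def by simp
  then have l: "l > 0" "l * l = L" by (simp_all add: l_def)
  have C: "C_const = 2 * l" by (simp add: C_const_def l_def L_def)
  have "- log 2 (7/24) = L" unfolding L_def by (simp add: log_divide)
  moreover have "((\<lambda>\<eta>. - log 2 (7/24 - \<eta>)) \<longlongrightarrow> - log 2 (7/24 - 0)) (at_right 0)"
    by (intro tendsto_intros) auto
  ultimately have "((\<lambda>\<eta>. - log 2 (7/24 - \<eta>)) \<longlongrightarrow> L) (at_right 0)" by simp
  \<comment> \<open>The excess \<epsilon> / 2 * l over L, multiplied by k of about s / l, costs half
    of the allowance \<epsilon> s.\<close>
  then have "eventually (\<lambda>\<eta>. - log 2 (7/24 - \<eta>) < L + \<epsilon> / 2 * l) (at_right 0)"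
    by (rule order_tendstoD) (use l assms in simp)
  moreover have "eventually (\<lambda>\<eta>. \<eta> \<in> {0<..<1/12}) (at_right (0::real))"
    by (rule eventually_at_right_real) simp
  ultimately have "eventually (\<lambda>\<eta>. - log 2 (7/24 - \<eta>) < L + \<epsilon> / 2 * l \<and> \<eta> \<in> {0<..<1/12}) (at_right 0)"
    by (rule eventually_conj)
  then obtain \<eta> where \<eta>: "- log 2 (7/24 - \<eta>) < L + \<epsilon> / 2 * l" "0 < \<eta>" "\<eta> < 1/12"
    using eventually_happens[of _ "at_right (0::real)"] by auto
  define c where "c = 7/24 - \<eta>"
  define L' where "L' = - log 2 c"
  have c: "0 < c" "c < 1" using \<eta> by (auto simp: c_def)
  have L': "0 \<le> L'" "L' < L + \<epsilon> / 2 * l" using c \<eta> by (auto simp: L'_def c_def)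
  define M where "M = 1024 * (6 / \<eta>\<^sup>2 + 2)"
  have M: "M > 0" unfolding M_def by (simp add: add_nonneg_pos)
  \<comment> \<open>The other half of the allowance covers rounding k up, which costs at most L',
    and the logarithm of the factor M k.\<close>
  have "eventually (\<lambda>s. L' + log 2 (M * (s / l + 1)) \<le> \<epsilon> / 2 * s) at_top"
    using assms l M by real_asymp
  moreover have "filterlim (\<lambda>N. sqrt (log 2 (real N))) at_top sequentially" by real_asymp
  ultimately have "eventually (\<lambda>N. L' + log 2 (M * (sqrt (log 2 (real N)) / l + 1))
      \<le> \<epsilon> / 2 * sqrt (log 2 (real N))) sequentially"
    by (rule eventually_compose_filterlim)
  then show ?thesis
    using eventually_ge_at_top[of 2]
  proof eventually_elim
    case (elim N)
    define s where "s = sqrt (log 2 (real N))"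
    have logN: "log 2 (real N) \<ge> 1" using elim by (simp add: le_log_iff)
    then have s: "s > 0" "s * s = log 2 (real N)" by (auto simp: s_def)
    define k where "k = nat \<lceil>s / l\<rceil>"
    have "s / l > 0" using s l by simp
    then have k: "s / l \<le> real k" "real k \<le> s / l + 1" "k \<ge> 1" unfolding k_def by linarith+
    have k0: "real k > 0" using k by simp
    have N0: "real N > 0" using elim by simp
    have "real N * c ^ k \<le> M * real k * real N powr (1 / real k) * real (r3 N)"
      using r3_lower_bound[of \<eta> N k] \<eta> elim k by (simp add: c_def M_def mult_ac)
    moreover have "c ^ k = 2 powr (- (real k * L'))"
    proof -
      have "c = 2 powr (- L')" using c by (simp add: L'_def)
      then show ?thesis by (metis mult.commute mult_minus_left powr_powr powr_realpow c(1))
    qed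
    moreover have "M * real k * real N powr (1 / real k)
        = 2 powr (log 2 (M * real k) + s * s / real k)"
    proof -
      have "real N powr (1 / real k) = 2 powr (log 2 (real N) * (1 / real k))"
        using N0 powr_powr[of 2 "log 2 (real N)" "1 / real k"] by (simp del: powr_powr)
      moreover have "M * real k = 2 powr log 2 (M * real k)" using M k0 by simp
      ultimately show ?thesis by (simp add: powr_add s)
    qed
    ultimately have "real N * 2 powr (- (real k * L')) \<le> 2 powr (log 2 (M * real k) + s * s / real k) * real (r3 N)"
      by simp
    then have "real N \<le> 2 powr (log 2 (M * real k) + s * s / real k) * real (r3 N) * 2 powr (real k * L')"
      by (simp only: mult_powr_minus_le_iff)
    also have "\<dots> = real (r3 N) * 2 powr (real k * L' + log 2 (M * real k) + s * s / real k)"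
      by (simp add: powr_add mult_ac)
    finally have bound: "real N * 2 powr (- (real k * L' + log 2 (M * real k) + s * s / real k)) \<le> real (r3 N)"
      by (simp only: mult_powr_minus_le_iff)
    have "real k * L' \<le> (s / l + 1) * L'" using k L' by (intro mult_right_mono) auto
    also have "\<dots> = s / l * L' + L'" by (simp add: algebra_simps)
    also have "s / l * L' \<le> s / l * (L + \<epsilon> / 2 * l)" using L' s l by (intro mult_left_mono) auto
    also have "s / l * (L + \<epsilon> / 2 * l) = l * s + \<epsilon> / 2 * s"
      unfolding l(2)[symmetric] using l(1) by (simp add: field_simps)
    finally have 1: "real k * L' \<le> l * s + \<epsilon> / 2 * s + L'" by simp
    have "s \<le> real k * l" using k(1) l by (simp add: divide_le_eq)
    then have "s * s \<le> s * (real k * l)" using s by (intro mult_left_mono) auto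
    then have 2: "s * s / real k \<le> l * s" using k0 by (simp add: divide_le_eq mult_ac)
    have "log 2 (M * real k) \<le> log 2 (M * (s / l + 1))"
      using k M k0 by (intro log_mono mult_left_mono) auto
    then have "real k * L' + log 2 (M * real k) + s * s / real k \<le> (C_const + \<epsilon>) * s"
      using 1 2 elim unfolding C s_def[symmetric] by (simp add: algebra_simps)
    then have "- (C_const + \<epsilon>) * s \<le> - (real k * L' + log 2 (M * real k) + s * s / real k)"
      by (simp only: mult_minus_left neg_le_iff_le)
    then have "2 powr (- (C_const + \<epsilon>) * s) \<le> 2 powr (- (real k * L' + log 2 (M * real k) + s * s / real k))"
      by (rule powr_mono) simp
    then have "real N * 2 powr (- (C_const + \<epsilon>) * s)
        \<le> real N * 2 powr (- (real k * L' + log 2 (M * real k) + s * s / real k))"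
      by (rule mult_left_mono) simp
    then show ?case using bound unfolding s_def by linarith
  qed
qed

section \<open>Extracting the o(1) term\<close>

lemma r3_pos: "N \<ge> 1 \<Longrightarrow> r3 N \<ge> 1"
  using r3_ge_card[of "{1}" N] by (simp add: three_AP_free_def)

theorem theorem1p1:
  shows "C_const < 2 * sqrt 2 \<and>
    (\<exists>\<epsilon> :: nat \<Rightarrow> real. \<epsilon> \<longlonglongrightarrow> 0 \<and>
      (\<forall>N :: nat. N \<ge> 1 \<longrightarrow>
        real (r3 N) \<ge> real N * 2 powr (- (C_const + \<epsilon> N) * sqrt (log 2 (real N)))))"
proof
  have "log 2 (24 / 7) < log 2 (4::real)" by (subst log_less_cancel_iff) auto
  also have "log 2 (4::real) = 2" using log_pow_cancel[of 2 2] by simp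
  finally show "C_const < 2 * sqrt 2" by (simp add: C_const_def)
next
  define s where "s N = sqrt (log 2 (real N))" for N :: nat
  \<comment> \<open>For N \<ge> 2 this is the least nonnegative value for which the inequality
    holds, so only the convergence needs the asymptotic bound. The maximum with 0 makes the limit
    from below immediate.\<close>
  define \<epsilon> where "\<epsilon> N = max 0 (log 2 (real N / real (r3 N)) / s N - C_const)" for N
  have upper: "eventually (\<lambda>N. \<epsilon> N \<le> e) sequentially" if e: "e > 0" for e
    using eventually_r3_ge[OF e] eventually_ge_at_top[of 2]
  proof eventually_elim
    case (elim N)
    have s: "s N > 0" using elim by (simp add: s_def)
    have r: "real (r3 N) > 0" using r3_pos[of N] elim by simp
    have "real N / real (r3 N) \<le> 2 powr ((C_const + e) * s N)"
      using elim(1) r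
      by (simp only: s_def mult_minus_left mult_powr_minus_le_iff pos_divide_le_eq) (simp only: mult.commute)
    then have "log 2 (real N / real (r3 N)) \<le> (C_const + e) * s N"
      using r elim by (simp add: log_le_iff)
    then show ?case unfolding \<epsilon>_def using s e by (simp add: field_simps)
  qed
  have "\<epsilon> \<longlonglongrightarrow> 0"
  proof (rule order_tendstoI)
    fix a :: real assume "a < 0"
    then show "eventually (\<lambda>N. a < \<epsilon> N) sequentially"
      by (intro always_eventually) (auto simp: \<epsilon>_def less_max_iff_disj)
  next
    fix a :: real assume "0 < a"
    then have "eventually (\<lambda>N. \<epsilon> N \<le> a / 2) sequentially" by (intro upper) simp
    then show "eventually (\<lambda>N. \<epsilon> N < a) sequentially"
      by eventually_elim (use \<open>0 < a\<close> in linarith)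
  qed
  moreover have "real N * 2 powr (- (C_const + \<epsilon> N) * sqrt (log 2 (real N))) \<le> real (r3 N)"
    if "N \<ge> 1" for N
  proof (cases "N = 1")
    case True
    \<comment> \<open>Here log 2 1 = 0, so the exponent vanishes whatever
      \<open>\<epsilon> 1\<close> is.\<close>
    then show ?thesis using r3_pos[of 1] by simp
  next
    case False
    then have N: "N \<ge> 2" using that by simp
    have s: "s N > 0" using N by (simp add: s_def)
    have r: "real (r3 N) > 0" using r3_pos[of N] N by simp
    have "log 2 (real N / real (r3 N)) / s N \<le> C_const + \<epsilon> N" by (simp add: \<epsilon>_def)
    then have "log 2 (real N / real (r3 N)) \<le> (C_const + \<epsilon> N) * s N" using s by (simp add: divide_le_eq)
    then have "real N / real (r3 N) \<le> 2 powr ((C_const + \<epsilon> N) * s N)"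
      using r N by (simp add: log_le_iff)
    then have "real N \<le> real (r3 N) * 2 powr ((C_const + \<epsilon> N) * s N)"
      using r by (simp only: pos_divide_le_eq mult.commute)
    then show ?thesis by (simp only: s_def mult_minus_left mult_powr_minus_le_iff)
  qed
  ultimately show "\<exists>\<epsilon> :: nat \<Rightarrow> real. \<epsilon> \<longlonglongrightarrow> 0 \<and>
      (\<forall>N :: nat. N \<ge> 1 \<longrightarrow>
        real (r3 N) \<ge> real N * 2 powr (- (C_const + \<epsilon> N) * sqrt (log 2 (real N))))"
    by blast
qed

end
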